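(* Let $n \ge 1$ be an integer and let $P \in \mathbb{C}[X, Y_0, \dots, Y_{n-1}]$ be a polynomial in $n+1$ variables. Let $(a_0, \dots, a_{n-1}) \in \mathbb{C}^n$ satisfy $a_i - a_j \notin \mathbb{Z}$ for all $0 \le i < j \le n-1$. Assume that $$P(s, \Gamma(s+a_0), \dots, \Gamma(s+a_{n-1})) \equiv 0$$ as a meromorphic function of $s \in \mathbb{C}$. Then $P$ is the zero polynomial.
   Context: $\Gamma$ denotes the Euler gamma function, defined by $\Gamma(s) = \int_0^{+\infty} t^{s-1} e^{-t}\, dt$ for $\Re s > 0$ and continued meromorphically to $\mathbb{C}$. The identity $P(s, \Gamma(s+a_0), \dots, \Gamma(s+a_{n-1})) \equiv 0$ is an identity of meromorphic functions of $s$ on $\mathbb{C}$, i.e. it holds at every $s \in \mathbb{C}$ at which none of $s + a_0, \dots, s + a_{n-1}$ is a pole of $\Gamma$ (a non-positive integer). *)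

theory Defs
  imports "HOL-Analysis.Analysis" "HOL-Library.Poly_Mapping"
begin

text \<open>
  A monomial is a finitely supported exponent function on variable indices, and a polynomial is a
  finitely supported family of coefficients indexed by monomials. The ring structure, and in
  particular the zero polynomial, is that of \<^theory>\<open>HOL-Library.Poly_Mapping\<close>.
\<close>

type_synonym 'a mpoly = "(nat \<Rightarrow>\<^sub>0 nat) \<Rightarrow>\<^sub>0 'a"

definition mpoly_vars :: "'a::zero mpoly \<Rightarrow> nat set" where
  "mpoly_vars P = (\<Union>m\<in>Poly_Mapping.keys P. Poly_Mapping.keys m)"

definition mpoly_eval :: "(nat \<Rightarrow> 'a) \<Rightarrow> 'a::comm_semiring_1 mpoly \<Rightarrow> 'a" where
  "mpoly_eval x P =
     (\<Sum>m\<in>Poly_Mapping.keys P. Poly_Mapping.lookup P m *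
        (\<Prod>k\<in>Poly_Mapping.keys m. x k ^ Poly_Mapping.lookup m k))"

text \<open>
  In \<open>C[X, Y_0, ..., Y_(n-1)]\<close> the index \<open>0\<close> stands for \<open>X\<close> and \<open>Suc i\<close> for \<open>Y_i\<close>, so that the
  polynomials in these variables are those with \<open>mpoly_vars P \<subseteq> {0..n}\<close>, and the point below
  is \<open>(s, \<Gamma>(s + a_0), \<Gamma>(s + a_1), ...)\<close>.
\<close>

definition Gamma_point :: "(nat \<Rightarrow> complex) \<Rightarrow> complex \<Rightarrow> nat \<Rightarrow> complex" where
  "Gamma_point a s k = (case k of 0 \<Rightarrow> s | Suc i \<Rightarrow> Gamma (s + a i))"

end

theory Submission imports Defs begin

text \<open>
  Over the polynomials in \<open>s\<close>, monomials in the \<open>\<Gamma>(s + a\<^sub>i)\<close> are hypergeometric terms: the shift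
  \<open>s \<mapsto> s + 1\<close> multiplies the monomial with exponents \<open>e\<close> by \<open>\<Prod>\<^sub>i (s + a\<^sub>i)^e\<^sub>i\<close>.
  Eliminating one monomial between a relation and its shift gives a shorter relation, hence a
  trivial one by induction. Its coefficients say that \<open>c\<^sub>e(s+1) c\<^sub>m(s) \<Prod>\<^sub>i (s + a\<^sub>i)^e\<^sub>i\<close> is symmetric
  in \<open>e\<close> and \<open>m\<close>. The number of roots in the class \<open>-a\<^sub>i + \<int>\<close> is invariant under the shift, so it
  gives \<open>e\<^sub>i = m\<^sub>i\<close> for every \<open>i\<close>.
\<close>

section \<open>Counting roots in a class modulo the integers\<close>

definition roots_in_class :: "'a::idom \<Rightarrow> 'a poly \<Rightarrow> nat" where
  "roots_in_class b p = size (filter_mset (\<lambda>z. z - b \<in> \<int>) (proots p))"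

lemma roots_in_class_mult:
  "p \<noteq> 0 \<Longrightarrow> q \<noteq> 0 \<Longrightarrow> roots_in_class b (p * q) = roots_in_class b p + roots_in_class b q"
  by (simp add: roots_in_class_def proots_mult)

lemma roots_in_class_linear:
  "roots_in_class b [:c, 1:] = (if - c - b \<in> \<int> then 1 else 0)"
  by (simp add: roots_in_class_def)

lemma roots_in_class_power: "roots_in_class b (p ^ k) = k * roots_in_class b p"
proof (cases "p = 0")
  case False
  then show ?thesis
    by (induction k) (auto simp: roots_in_class_mult, simp add: roots_in_class_def)
next
  case True
  then show ?thesis
    by (cases k) (auto simp: roots_in_class_def)
qed

lemma roots_in_class_prod:
  "(\<And>i. i \<in> A \<Longrightarrow> f i \<noteq> 0) \<Longrightarrow>
    roots_in_class b (\<Prod>i\<in>A. f i) = (\<Sum>i\<in>A. roots_in_class b (f i))"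
  by (induction A rule: infinite_finite_induct)
    (auto simp: roots_in_class_mult, simp_all add: roots_in_class_def)

lemma pcompose_shift_eq_0_iff: "pcompose p [:c, 1:] = 0 \<longleftrightarrow> p = (0 :: 'a::idom poly)"
  by (simp add: pcompose_eq_0_iff)

text \<open>Each root r moves to r - 1, which differs from b by an integer exactly when r does. The
  induction splits off linear factors; the base ring need not be algebraically closed, because a
  factor without roots stays so after the shift.\<close>

lemma roots_in_class_shift:
  "roots_in_class b (pcompose p [:1, 1:]) = roots_in_class b (p :: 'a::idom poly)"
proof (induction p rule: poly_root_induct[of _ "\<lambda>_. True"])
  case 0
  then show ?case by simp
next
  case (no_roots p)
  then have "p \<noteq> 0" "pcompose p [:1, 1:] \<noteq> 0"
    by (auto simp: pcompose_shift_eq_0_iff)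
  then have "proots p = {#}" "proots (pcompose p [:1, 1:]) = {#}"
    using no_roots by (auto simp: multiset_eq_iff order_eq_0_iff poly_pcompose)
  then show ?case by (simp add: roots_in_class_def)
next
  case (root r p)
  show ?case
  proof (cases "p = 0")
    case False
    have "r - 1 - b \<in> \<int> \<longleftrightarrow> r - b \<in> \<int>"
      using Ints_add[OF _ Ints_1, of "r - 1 - b"] Ints_diff[OF _ Ints_1, of "r - b"]
      by (auto simp: algebra_simps)
    \<comment> \<open>The induction rule yields factors r - x, while
      \<open>roots_in_class_linear\<close> covers monic ones; the sign does not affect the
      roots.\<close>
    moreover have "[:r, -1:] = - [:-r, 1:]" "[:r - 1, -1:] = - [:-(r - 1), 1:]"
      by simp_all
    moreover have "roots_in_class b (- q) = roots_in_class b q" for q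
      by (simp add: roots_in_class_def)
    ultimately have "roots_in_class b [:r - 1, -1:] = roots_in_class b [:r, -1:]"
      by (simp only: roots_in_class_linear) simp
    moreover have "pcompose [:r, -1:] [:1, 1:] = [:r - 1, -1:]"
      by (simp add: pcompose_pCons)
    ultimately show ?thesis
      using False root
      by (simp del: mult_pCons_left add: pcompose_mult roots_in_class_mult pcompose_shift_eq_0_iff)
  qed simp
qed

definition shift_factor :: "nat \<Rightarrow> (nat \<Rightarrow> 'a::idom) \<Rightarrow> (nat \<Rightarrow> nat) \<Rightarrow> 'a poly" where
  "shift_factor n a e = (\<Prod>i<n. [:a i, 1:] ^ e i)"

lemma shift_factor_nonzero: "shift_factor n a e \<noteq> 0"
  by (simp add: shift_factor_def)

text \<open>The root -a_j of the j-th factor lies in the class of -a_i only for j = i, so this class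
  isolates the single exponent e_i.\<close>

lemma roots_in_class_shift_factor:
  assumes "i < n" "\<And>j. j < n \<Longrightarrow> j \<noteq> i \<Longrightarrow> a i - a j \<notin> \<int>"
  shows "roots_in_class (- a i) (shift_factor n a e) = e i"
proof -
  have "roots_in_class (- a i) (shift_factor n a e)
      = (\<Sum>j<n. e j * (if a i - a j \<in> \<int> then 1 else 0))"
    by (simp add: shift_factor_def roots_in_class_prod roots_in_class_power roots_in_class_linear)
  also have "\<dots> = (\<Sum>j<n. if j = i then e i else 0)"
    using assms by (intro sum.cong) auto
  finally show ?thesis
    using assms(1) by simp
qed

section \<open>Monomials in shifted Gamma values, away from the poles\<close>

definition Gamma_monom :: "nat \<Rightarrow> (nat \<Rightarrow> complex) \<Rightarrow> (nat \<Rightarrow> nat) \<Rightarrow> complex \<Rightarrow> complex" where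
  "Gamma_monom n a e s = (\<Prod>i<n. Gamma (s + a i) ^ e i)"

definition Gamma_poles :: "nat \<Rightarrow> (nat \<Rightarrow> complex) \<Rightarrow> complex set" where
  "Gamma_poles n a = {s. \<exists>i<n. s + a i \<in> \<int>\<^sub>\<le>\<^sub>0}"

lemma Gamma_monom_nonzero: "s \<notin> Gamma_poles n a \<Longrightarrow> Gamma_monom n a e s \<noteq> 0"
  by (auto simp: Gamma_monom_def Gamma_poles_def Gamma_eq_zero_iff)

lemma Gamma_poles_plus1: "s \<notin> Gamma_poles n a \<Longrightarrow> s + 1 \<notin> Gamma_poles n a"
  unfolding Gamma_poles_def mem_Collect_eq
  by (metis add.assoc add.commute plus_one_in_nonpos_Ints_imp)

lemma Gamma_monom_plus1:
  assumes "s \<notin> Gamma_poles n a"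
  shows "Gamma_monom n a e (s + 1) = poly (shift_factor n a e) s * Gamma_monom n a e s"
proof -
  have "Gamma (s + 1 + a i) = (s + a i) * Gamma (s + a i)" if "i < n" for i
    using assms that Gamma_plus1[of "s + a i"] by (auto simp: Gamma_poles_def add_ac)
  then show ?thesis
    by (simp add: Gamma_monom_def shift_factor_def poly_prod power_mult_distrib
        prod.distrib[symmetric] add.commute)
qed

text \<open>Every large natural number s makes all s + a_i have positive real part. This lets a
  polynomial that vanishes off the poles be recognised as zero.\<close>

lemma infinite_Compl_Gamma_poles: "infinite (- Gamma_poles n a)"
proof -
  obtain N where N: "\<And>i. i < n \<Longrightarrow> - Re (a i) < real N"
  proof -
    obtain N where N: "(\<Sum>i<n. \<bar>Re (a i)\<bar>) < real N"
      using reals_Archimedean2 by blast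
    have "- Re (a i) < real N" if "i < n" for i
      using member_le_sum[of i "{..<n}" "\<lambda>i. \<bar>Re (a i)\<bar>"] that N by auto
    then show ?thesis using that by blast
  qed
  have "of_nat ` {N..} \<subseteq> - Gamma_poles n a"
  proof
    fix s :: complex
    assume "s \<in> of_nat ` {N..}"
    then have "Re s \<ge> real N" by auto
    then have "Re (s + a i) > 0" if "i < n" for i
      using N[OF that] by simp
    moreover have "Re z \<le> 0" if "z \<in> \<int>\<^sub>\<le>\<^sub>0" for z
      using that by (auto elim!: nonpos_Ints_cases)
    ultimately show "s \<in> - Gamma_poles n a"
      by (fastforce simp: Gamma_poles_def)
  qed
  moreover have "infinite (of_nat ` {N..} :: complex set)"
    by (simp add: finite_image_iff inj_on_def infinite_Ici)
  ultimately show ?thesis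
    using infinite_super by blast
qed

text \<open>The vanishing of e beyond n ensures that distinct members of M are distinct monomials.
  The coefficients c stay arbitrary in the induction, because the eliminated relation has new
  ones.\<close>

lemma Gamma_monom_independent:
  assumes "finite M" "\<And>e i. e \<in> M \<Longrightarrow> i \<ge> n \<Longrightarrow> e i = 0"
    and a: "\<And>i j. i < n \<Longrightarrow> j < n \<Longrightarrow> i \<noteq> j \<Longrightarrow> a i - a j \<notin> \<int>"
    and "\<And>s. s \<notin> Gamma_poles n a \<Longrightarrow> (\<Sum>e\<in>M. poly (c e) s * Gamma_monom n a e s) = 0"
  shows "\<forall>e\<in>M. c e = 0"
  using assms(1,2,4)
proof (induction M arbitrary: c rule: finite_induct)
  case empty
  then show ?case by simp
next
  case (insert m M)
  let ?G = "Gamma_monom n a" and ?Q = "shift_factor n a"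
  define S where "S c s = (\<Sum>e\<in>M. poly (c e) s * ?G e s)" for c s
  have rel: "S c s = - (poly (c m) s * ?G m s)" if "s \<notin> Gamma_poles n a" for s
    using insert.prems(2)[OF that] insert.hyps by (simp add: S_def eq_neg_iff_add_eq_0 add.commute)
  show ?case
  proof (cases "c m = 0")
    case True
    then show ?thesis
      using insert.IH[of c] insert.prems(1) rel by (simp add: S_def)
  next
    case False
    let ?T = "\<lambda>p. pcompose p [:1, 1:]"
    \<comment> \<open>Coefficients of c_m(s) times the shifted relation minus c_m(s+1) Q_m(s) times
      the original one, where Q_m is the shift factor of m: the term of m cancels.\<close>
    define d where "d e = ?T (c e) * ?Q e * c m - ?T (c m) * ?Q m * c e" for e
    have "S d s = 0" if s: "s \<notin> Gamma_poles n a" for s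
    proof -
      have "S d s = poly (c m) s * S c (s + 1) - poly (c m) (s + 1) * poly (?Q m) s * S c s"
        unfolding S_def sum_distrib_left sum_subtractf[symmetric]
        by (intro sum.cong)
          (simp_all add: d_def poly_pcompose Gamma_monom_plus1[OF s, unfolded add.commute[of s 1]]
            algebra_simps)
      \<comment> \<open>By \<open>rel\<close>, both products equal -c_m(s) c_m(s+1) Q_m(s) G_m(s),
        with G_m the monomial of m.\<close>
      then show ?thesis
        using rel[OF s] rel[OF Gamma_poles_plus1[OF s]] Gamma_monom_plus1[OF s, of m]
        by simp
    qed
    then have d: "d e = 0" if "e \<in> M" for e
      using insert.IH[of d] insert.prems(1) that by (simp add: S_def)
    have c0: "c e = 0" if e: "e \<in> M" for e
    proof (rule ccontr)
      assume nz: "c e \<noteq> 0"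
      have eq: "?T (c e) * ?Q e * c m = ?T (c m) * ?Q m * c e"
        using d[OF e] by (simp add: d_def)
      have "e i = m i" for i
      proof (cases "i < n")
        case True
        have "roots_in_class (- a i) (?Q e) = e i" "roots_in_class (- a i) (?Q m) = m i"
          using True a by (auto intro!: roots_in_class_shift_factor)
        then show ?thesis
          \<comment> \<open>The counts for c_e and c_m occur on both sides, by shift invariance, and
            cancel.\<close>
          using arg_cong[OF eq, of "roots_in_class (- a i)"] nz False
          by (simp add: roots_in_class_mult roots_in_class_shift shift_factor_nonzero
              pcompose_shift_eq_0_iff)
      next
        case False
        then show ?thesis
          using insert.prems(1)[of e i] insert.prems(1)[of m i] e by simp
      qed
      then have "e = m" by blast
      then show False using e insert.hyps by blast
    qed
    \<comment> \<open>Only the term of m is left, and its Gamma monomial has no zeros here.\<close>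
    have "poly (c m) s = 0" if "s \<notin> Gamma_poles n a" for s
      using rel[OF that] Gamma_monom_nonzero[OF that] c0 by (simp add: S_def)
    then have "- Gamma_poles n a \<subseteq> {s. poly (c m) s = 0}" by blast
    then have "infinite {s. poly (c m) s = 0}"
      using infinite_Compl_Gamma_poles infinite_super by blast
    then show ?thesis
      using False poly_roots_finite by blast
  qed
qed

section \<open>Reading P as a polynomial in the Y_i over C[X]\<close>

theorem theorem1:
  fixes n :: nat and P :: "complex mpoly" and a :: "nat \<Rightarrow> complex"
  assumes "n \<ge> 1"
    and "mpoly_vars P \<subseteq> {0..n}"
    and "\<And>i j. i < j \<Longrightarrow> j < n \<Longrightarrow> a i - a j \<notin> \<int>"
    and "\<And>s. (\<And>i. i < n \<Longrightarrow> s + a i \<notin> \<int>\<^sub>\<le>\<^sub>0) \<Longrightarrow> mpoly_eval (Gamma_point a s) P = 0"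
  shows "P = 0"
proof -
  let ?K = "Poly_Mapping.keys P" and ?l = "Poly_Mapping.lookup"
  \<comment> \<open>\<open>E m\<close> keeps the exponents of the Y_i; \<open>c e\<close> collects
    the powers of X that accompany Y^e.\<close>
  define E where "E m i = ?l m (Suc i)" for m :: "nat \<Rightarrow>\<^sub>0 nat" and i
  define c where "c e = (\<Sum>m | m \<in> ?K \<and> E m = e. monom (?l P m) (?l m 0))" for e
  have supp: "?l m k = 0" if "m \<in> ?K" "k > n" for m k
    using assms(2) that by (force simp: mpoly_vars_def subset_iff in_keys_iff)
  have a: "a i - a j \<notin> \<int>" if "i < n" "j < n" "i \<noteq> j" for i j
    using assms(3)[of i j] assms(3)[of j i] that Ints_minus[of "a i - a j"]
    by (cases "i < j") auto
  have eval: "mpoly_eval (Gamma_point a s) P = (\<Sum>e\<in>E ` ?K. poly (c e) s * Gamma_monom n a e s)"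
    for s
  proof -
    have "(\<Prod>k\<in>Poly_Mapping.keys m. Gamma_point a s k ^ ?l m k)
        = s ^ ?l m 0 * Gamma_monom n a (E m) s" if "m \<in> ?K" for m
    proof -
      have "(\<Prod>k\<in>Poly_Mapping.keys m. Gamma_point a s k ^ ?l m k)
          = (\<Prod>k<Suc n. Gamma_point a s k ^ ?l m k)"
      proof (rule prod.mono_neutral_left)
        show "Poly_Mapping.keys m \<subseteq> {..<Suc n}"
          using supp[OF that] by (metis in_keys_iff lessThan_iff not_less_eq subsetI)
      qed (auto simp: in_keys_iff)
      then show ?thesis
        by (simp add: prod.lessThan_Suc_shift Gamma_point_def Gamma_monom_def E_def
            del: prod.lessThan_Suc)
    qed
    then have "mpoly_eval (Gamma_point a s) P
        = (\<Sum>m\<in>?K. ?l P m * s ^ ?l m 0 * Gamma_monom n a (E m) s)"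
      by (simp add: mpoly_eval_def mult.assoc)
    also have "\<dots> = (\<Sum>e\<in>E ` ?K. \<Sum>m | m \<in> ?K \<and> E m = e.
        ?l P m * s ^ ?l m 0 * Gamma_monom n a (E m) s)"
      by (intro sum.image_gen) simp
    also have "\<dots> = (\<Sum>e\<in>E ` ?K. poly (c e) s * Gamma_monom n a e s)"
      by (simp add: c_def poly_sum poly_monom sum_distrib_right)
    finally show ?thesis .
  qed
  have c0: "\<forall>e\<in>E ` ?K. c e = 0"
  proof (rule Gamma_monom_independent)
    show "finite (E ` ?K)" by simp
    show "e i = 0" if "e \<in> E ` ?K" "i \<ge> n" for e i
      using that supp by (auto simp: E_def)
    show "(\<Sum>e\<in>E ` ?K. poly (c e) s * Gamma_monom n a e s) = 0" if "s \<notin> Gamma_poles n a" for s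
      using assms(4)[of s] that unfolding eval[symmetric] by (auto simp: Gamma_poles_def)
  qed (use a in auto)
  have "m \<notin> ?K" for m
  proof
    assume m: "m \<in> ?K"
    \<comment> \<open>The exponent of X and \<open>E m\<close> determine m, so each coefficient of
      \<open>c (E m)\<close> comes from at most one monomial of P and nothing can cancel.\<close>
    have inj: "m' = m" if "E m' = E m" "?l m' 0 = ?l m 0" for m'
    proof (rule poly_mapping_eqI)
      show "?l m' k = ?l m k" for k
        using that by (cases k) (auto simp: E_def fun_eq_iff)
    qed
    have "coeff (c (E m)) (?l m 0)
        = (\<Sum>m' | m' \<in> ?K \<and> E m' = E m. if m' = m then ?l P m else 0)"
      unfolding c_def coeff_sum using inj by (intro sum.cong) auto
    also have "\<dots> = ?l P m"
      using m by (simp add: sum.delta')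
    finally show False
      using c0 m by (simp add: in_keys_iff)
  qed
  then have "?K = {}" by blast
  then show ?thesis by simp
qed

end
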